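(* Let $n\ge 2$, let $K\subset\mathbb{R}^n$ be an $o$-symmetric convex body with non-empty interior, let $\Lambda\subset\mathbb{R}^n$ be a lattice of rank $n$, and let $\Lambda_1,\dots,\Lambda_s\subset\Lambda$ ($s\ge 1$) be sublattices, each of rank $n$, such that $\bigcup_{i=1}^s\Lambda_i\neq\Lambda$. Put $\overline{\Lambda}=\bigcap_{i=1}^s\Lambda_i$ (which is again a lattice of rank $n$). Then $$\lambda_1\Bigl(K,\Lambda\setminus\bigcup_{i=1}^s\Lambda_i\Bigr)<\frac{2^n\det\Lambda}{\lambda_1(K,\overline{\Lambda})^{n-1}\operatorname{vol}(K)}\left(\sum_{i=1}^s\frac{\det\overline{\Lambda}}{\det\Lambda_i}-s+1\right)+\lambda_1(K,\overline{\Lambda}).$$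
   Context: An $o$-symmetric convex body is a compact convex set $K\subset\mathbb{R}^n$ with $K=-K$; $\operatorname{vol}$ is $n$-dimensional Lebesgue measure. A lattice $\Lambda\subset\mathbb{R}^n$ is a discrete additive subgroup (the $\mathbb{Z}$-span of $r$ linearly independent vectors, $r=\operatorname{rank}\Lambda\le n$); $\det\Lambda$ is the $r$-dimensional volume of a fundamental cell of $\Lambda$. For a set $X\subset\mathbb{R}^n$, $\dim X$ denotes here the dimension of its linear span (the maximal number of linearly independent points of $X$). The successive minima are $\lambda_i(K,\Lambda)=\min\{\lambda\ge 0:\dim(\lambda K\cap\Lambda)\ge i\}$ for $1\le i\le\operatorname{rank}\Lambda$. For sublattices $\Lambda_1,\dots,\Lambda_s\subset\Lambda$ with $\bigcup_{i=1}^s\Lambda_i\neq\Lambda$ the $j$-th restricted successive minimum is $\lambda_j(K,\Lambda\setminus\bigcup_{i=1}^s\Lambda_i)=\min\{\lambda\ge 0:\dim(\lambda K\cap(\Lambda\setminus\bigcup_{i=1}^s\Lambda_i))\ge j\}$ for $1\le j\le\operatorname{rank}\Lambda$. *)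

theory Defs
  imports "HOL-Analysis.Analysis"
begin

definition euclidean_lattice :: "'a::euclidean_space set \<Rightarrow> bool" where
  "euclidean_lattice L \<longleftrightarrow> 0 \<in> L \<and> (\<forall>x\<in>L. \<forall>y\<in>L. x - y \<in> L) \<and> discrete L"

definition symmetric_convex_body :: "'a::euclidean_space set \<Rightarrow> bool" where
  "symmetric_convex_body K \<longleftrightarrow> compact K \<and> convex K \<and> K = uminus ` K"

definition int_span :: "'a::euclidean_space set \<Rightarrow> 'a set" where
  "int_span B = {\<Sum>b\<in>B. of_int (c b) *\<^sub>R b | c :: 'a \<Rightarrow> int. True}"

text \<open>\<^const>\<open>independent\<close> is linear independence over the reals; it forces \<open>B\<close> to be finite.\<close>
definition lattice_basis :: "'a::euclidean_space set \<Rightarrow> 'a set \<Rightarrow> bool" where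
  "lattice_basis B L \<longleftrightarrow> independent B \<and> L = int_span B"

definition fundamental_cell :: "'a::euclidean_space set \<Rightarrow> 'a set" where
  "fundamental_cell B = {\<Sum>b\<in>B. t b *\<^sub>R b | t :: 'a \<Rightarrow> real. \<forall>b\<in>B. 0 \<le> t b \<and> t b < 1}"

text \<open>Meaningful for lattices \<open>L\<close> of full rank only: the volume of the cell is the full-dimensional
  Lebesgue measure, which vanishes in lower rank. The value does not depend on the chosen basis.\<close>
definition lattice_det :: "'a::euclidean_space set \<Rightarrow> real" where
  "lattice_det L = measure lebesgue (fundamental_cell (SOME B. lattice_basis B L))"

text \<open>The library's \<^const>\<open>dim\<close> of a set is the dimension of its linear span, so the rank of a lattice
  \<open>L\<close> is \<open>dim L\<close>. The successive minima of a lattice \<open>L\<close> are obtained with \<open>X = L\<close>, the restricted ones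
  with \<open>X = L - (\<Union>i. L\<^sub>i)\<close>. \<^const>\<open>Least\<close> on the reals is the minimum whenever it is attained.\<close>
definition successive_min :: "nat \<Rightarrow> 'a::euclidean_space set \<Rightarrow> 'a set \<Rightarrow> real" where
  "successive_min i K X = (LEAST l::real. 0 \<le> l \<and> i \<le> dim ((\<lambda>x. l *\<^sub>R x) ` K \<inter> X))"

end

theory Submission
  imports Defs
begin

text \<open>Let \<open>\<alpha>\<close> be the first minimum of the intersection lattice \<open>M\<close> and \<open>\<beta>\<close> the first restricted minimum,
  attained at \<open>x\<close>. The coset \<open>x + M\<close> avoids all sublattices, so \<open>x\<close> is a shortest vector of it and the
  points of the segment from \<open>0\<close> to \<open>x\<close> have \<open>0\<close> as a nearest point of \<open>M\<close>. Hence, with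
  \<open>k = \<lfloor>\<beta> / \<alpha>\<rfloor>\<close>, the \<open>k\<close> translates of \<open>(\<alpha>/2) int K\<close> along this segment with spacing \<open>\<alpha>\<close> are disjoint
  modulo \<open>M\<close>. Lattice points that are differences of points of their union \<open>S\<close> have length less than
  \<open>k \<alpha> \<le> \<beta>\<close>, so they lie in the union of the sublattices, which consists of at most
  \<open>\<Sum>(det M / det \<Lambda>\<^sub>i) - s + 1\<close> cosets of \<open>M\<close>. By averaging, \<open>vol S = k (\<alpha>/2)\<^sup>n vol K\<close> is at most that
  many times \<open>det \<Lambda>\<close>, and \<open>k > \<beta> / \<alpha> - 1\<close>.\<close>

section \<open>Bases and fundamental domains\<close>

lemma lattice_zero: "euclidean_lattice L \<Longrightarrow> 0 \<in> L"
  by (simp add: euclidean_lattice_def)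

lemma lattice_diff: "euclidean_lattice L \<Longrightarrow> x \<in> L \<Longrightarrow> y \<in> L \<Longrightarrow> x - y \<in> L"
  by (simp add: euclidean_lattice_def)

lemma lattice_minus: "euclidean_lattice L \<Longrightarrow> x \<in> L \<Longrightarrow> - x \<in> L"
  using lattice_diff[of L 0 x] by (simp add: lattice_zero)

lemma lattice_add: "euclidean_lattice L \<Longrightarrow> x \<in> L \<Longrightarrow> y \<in> L \<Longrightarrow> x + y \<in> L"
  using lattice_diff[of L x "- y"] by (simp add: lattice_minus)

lemma lattice_of_nat_scale:
  assumes "euclidean_lattice L" "x \<in> L"
  shows "real n *\<^sub>R x \<in> L"
  by (induction n) (auto simp: assms lattice_zero lattice_add algebra_simps)

lemma lattice_of_int_scale:
  assumes "euclidean_lattice L" "x \<in> L"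
  shows "of_int k *\<^sub>R x \<in> L"
proof (cases "0 \<le> k")
  case True
  then show ?thesis using lattice_of_nat_scale[OF assms, of "nat k"] by simp
next
  case False
  then show ?thesis
    using lattice_minus[OF assms(1) lattice_of_nat_scale[OF assms, of "nat (- k)"]] by simp
qed

lemma lattice_sum:
  assumes "euclidean_lattice L" "\<And>i. i \<in> I \<Longrightarrow> f i \<in> L"
  shows "sum f I \<in> L"
  using assms(2) by (induction I rule: infinite_finite_induct)
    (auto simp: assms(1) lattice_zero lattice_add)

lemma int_span_base:
  assumes "finite B" "b \<in> B"
  shows "b \<in> int_span B"
  unfolding int_span_def
proof (intro CollectI exI conjI)
  have "(\<Sum>x\<in>B. of_int (if x = b then 1 else 0) *\<^sub>R x) = (\<Sum>x\<in>B. if x = b then x else 0)"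
    by (intro sum.cong) auto
  then show "b = (\<Sum>x\<in>B. of_int (if x = b then 1 else 0) *\<^sub>R x)"
    using assms by simp
qed simp

lemma int_span_subset_span: "int_span B \<subseteq> span B"
  unfolding int_span_def by clarify (intro span_sum span_scale span_base)

lemma int_span_subset_lattice:
  assumes "euclidean_lattice L" "B \<subseteq> L"
  shows "int_span B \<subseteq> L"
  using assms by (auto simp: int_span_def intro!: lattice_sum lattice_of_int_scale)

text \<open>Isolation of \<open>0\<close> alone gives a radius that works everywhere, since the
  difference of two lattice points is again a lattice point. Uniformity is what yields finiteness in
  bounded sets and closedness of every subset.\<close>

lemma lattice_uniform_discrete:
  assumes "euclidean_lattice L"
  shows "uniform_discrete L"
proof -
  have "0 isolated_in L"
    using assms by (simp add: euclidean_lattice_def discrete_def)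
  then obtain e where e: "e > 0" "\<And>y. y \<in> L \<Longrightarrow> norm y < e \<Longrightarrow> y = 0"
    by (auto simp: isolated_in_dist_Ex_iff)
  show ?thesis
    unfolding uniform_discrete_def
    using e lattice_diff[OF assms] by (force simp: dist_norm)
qed

lemma finite_lattice_Int_bounded:
  assumes "euclidean_lattice L" "bounded A"
  shows "finite (L \<inter> A)"
  using uniform_discrete_finite_iff[of "L \<inter> A"] lattice_uniform_discrete[OF assms(1)] assms(2)
  by (metis bounded_Int inf_le1 uniform_discrete_subset)

lemma countable_lattice:
  assumes "euclidean_lattice L"
  shows "countable L"
proof -
  have "L = (\<Union>n::nat. L \<inter> cball 0 n)"
    using real_arch_simple by auto
  moreover have "countable (L \<inter> cball 0 (real n))" for n
    by (intro countable_finite finite_lattice_Int_bounded assms bounded_cball)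
  ultimately show ?thesis by (metis countable_UN countableI_type)
qed

section \<open>Coordinates and existence of lattice bases\<close>

lemma dual_family:
  fixes B :: "'a::euclidean_space set"
  assumes B: "independent B"
  shows "\<exists>f :: 'a \<Rightarrow> 'a \<Rightarrow> real. (\<forall>b. linear (f b)) \<and>
    (\<forall>b\<in>B. \<forall>t. f b (\<Sum>c\<in>B. t c *\<^sub>R c) = t b) \<and>
    (\<forall>x\<in>span B. (\<Sum>b\<in>B. f b x *\<^sub>R b) = x)"
proof -
  have fin: "finite B" using B by (rule independent_imp_finite)
  \<comment> \<open>The coordinate functional of \<open>b\<close> is extended linearly to the whole
    space, so that it may be applied outside \<open>span B\<close> as well; only the expansion
    formula is confined to \<open>span B\<close>.\<close>
  have "\<exists>g. linear g \<and> (\<forall>x\<in>B. g x = (if x = b then 1 else 0::real))" for b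
    using linear_independent_extend[OF B, of "\<lambda>x. if x = b then 1 else 0::real"] by blast
  then obtain f :: "'a \<Rightarrow> 'a \<Rightarrow> real"
    where f: "\<And>b. linear (f b)" "\<And>b x. x \<in> B \<Longrightarrow> f b x = (if x = b then 1 else 0)"
    by metis
  have 2: "f b (\<Sum>c\<in>B. t c *\<^sub>R c) = t b" if "b \<in> B" for b t
  proof -
    have "f b (\<Sum>c\<in>B. t c *\<^sub>R c) = (\<Sum>c\<in>B. t c * f b c)"
      by (simp add: linear_sum[OF f(1)] linear_cmul[OF f(1)])
    also have "\<dots> = (\<Sum>c\<in>B. if c = b then t c else 0)"
      by (intro sum.cong) (auto simp: f(2))
    finally show ?thesis using that fin by simp
  qed
  have "(\<Sum>b\<in>B. f b x *\<^sub>R b) = x" if x: "x \<in> span B" for x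
  proof -
    obtain u where "x = (\<Sum>c\<in>B. u c *\<^sub>R c)"
      using x unfolding span_finite[OF fin] by blast
    then show ?thesis using 2 by auto
  qed
  with f(1) 2 show ?thesis by blast
qed

text \<open>Serves twice: it makes the candidate set in the extension step for bases finite, and it
  bounds the fundamental cell.\<close>

lemma bounded_bounded_combinations:
  fixes B :: "'a::euclidean_space set"
  shows "bounded {\<Sum>b\<in>B. t b *\<^sub>R b | t. \<forall>b\<in>B. \<bar>t b\<bar> \<le> 1}"
proof -
  have "norm (\<Sum>b\<in>B. t b *\<^sub>R b) \<le> (\<Sum>b\<in>B. norm b)" if "\<forall>b\<in>B. \<bar>t b\<bar> \<le> 1" for t
  proof -
    have "norm (\<Sum>b\<in>B. t b *\<^sub>R b) \<le> (\<Sum>b\<in>B. norm (t b *\<^sub>R b))"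
      by (rule norm_sum)
    also have "\<dots> \<le> (\<Sum>b\<in>B. norm b)"
      using that by (intro sum_mono) (simp add: mult_left_le_one_le)
    finally show ?thesis .
  qed
  then show ?thesis
    by (auto simp: bounded_iff)
qed

text \<open>Adding a new direction \<open>b\<close> to a basis \<open>C\<close> of the lattice points in a subspace: among the
  lattice points with smallest positive \<open>b\<close>-coordinate choose one; modulo \<open>C\<close> there are only
  finitely many candidates.\<close>
lemma int_span_extend:
  fixes L :: "'a::euclidean_space set"
  assumes L: "euclidean_lattice L" and C: "independent C" "L \<inter> span C = int_span C"
    and b: "b \<in> L" "b \<notin> span C"
  obtains d where "d \<notin> span C" "span (insert d C) = span (insert b C)"
    "L \<inter> span (insert b C) = int_span (insert d C)"
proof -
  define E where "E = insert b C"
  have E: "independent E" using C b by (simp add: E_def independent_insertI)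
  have fin: "finite C" using C independent_imp_finite by blast
  have bC: "b \<notin> C" using b span_base by blast
  obtain f :: "'a \<Rightarrow> 'a \<Rightarrow> real"
    where f: "(\<forall>e. linear (f e)) \<and>
      (\<forall>e\<in>E. \<forall>t. f e (\<Sum>c\<in>E. t c *\<^sub>R c) = t e) \<and>
      (\<forall>x\<in>span E. (\<Sum>e\<in>E. f e x *\<^sub>R e) = x)"
    using dual_family[OF E] ..
  note lin = f[THEN conjunct1, rule_format]
    and val = f[THEN conjunct2, THEN conjunct1, rule_format]
    and rep = f[THEN conjunct2, THEN conjunct2, rule_format]
  have CL: "C \<subseteq> L"
    using int_span_base[OF fin] C(2) by blast
  have val1: "f e c = (if c = e then 1 else 0)" if "e \<in> E" "c \<in> E" for e c
  proof -
    have "(\<Sum>x\<in>E. (if x = c then 1 else 0) *\<^sub>R x) = (\<Sum>x\<in>E. if x = c then x else 0)"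
      by (intro sum.cong) auto
    also have "\<dots> = c" using fin that by (simp add: E_def)
    finally show ?thesis using val[OF that(1), of "\<lambda>x. if x = c then 1 else 0"] by auto
  qed
  \<comment> \<open>The candidates: the \<open>b\<close>-coordinate is positive and at most that of
    \<open>b\<close>, the other coordinates are reduced modulo 1. The set is bounded, hence finite,
    and it contains \<open>b\<close>.\<close>
  define T where "T = {x \<in> L \<inter> span E. 0 < f b x \<and> f b x \<le> 1 \<and> (\<forall>c\<in>C. 0 \<le> f c x \<and> f c x < 1)}"
  have "T \<subseteq> L \<inter> {\<Sum>e\<in>E. t e *\<^sub>R e | t. \<forall>e\<in>E. \<bar>t e\<bar> \<le> 1}"
  proof
    fix x assume x: "x \<in> T"
    then have "x = (\<Sum>e\<in>E. f e x *\<^sub>R e)" "\<forall>e\<in>E. \<bar>f e x\<bar> \<le> 1"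
      using rep[of x] by (auto simp: T_def E_def)
    then show "x \<in> L \<inter> {\<Sum>e\<in>E. t e *\<^sub>R e | t. \<forall>e\<in>E. \<bar>t e\<bar> \<le> 1}"
      using x by (auto simp: T_def intro!: exI[of _ "\<lambda>e. f e x"])
  qed
  then have finT: "finite T"
    using finite_lattice_Int_bounded[OF L bounded_bounded_combinations] finite_subset by blast
  have "b \<in> T"
    using b bC val1[of _ b] by (auto simp: T_def E_def span_base)
  then have "T \<noteq> {}" by blast
  then obtain d where d: "d \<in> T" "\<And>x. x \<in> T \<Longrightarrow> f b d \<le> f b x"
    using ex_is_arg_min_if_finite[OF finT, of "f b"] by (auto simp: is_arg_min_linorder)
  have dL: "d \<in> L" "d \<in> span E" "0 < f b d" using d(1) by (auto simp: T_def)
  have fC0: "f b x = 0" if "x \<in> span C" for x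
  proof -
    have "x \<in> {x. f b x = 0}"
      using that
    proof (rule subsetD[OF span_minimal, rotated 2])
      show "C \<subseteq> {x. f b x = 0}" using val1[of b] bC by (auto simp: E_def)
      show "subspace {x. f b x = 0}" by (rule linear_subspace_kernel[OF lin])
    qed
    then show ?thesis by simp
  qed
  have dC: "d \<notin> span C" using fC0 dL(3) by fastforce
  have span_eq: "span (insert d C) = span E"
  proof
    show "span (insert d C) \<subseteq> span E"
      using dL(2) by (intro span_minimal) (auto simp: E_def span_base)
    have "b \<in> span (insert d C)"
      using in_span_insert[of d b C] dL(2) dC by (simp add: E_def)
    then show "span E \<subseteq> span (insert d C)"
      by (intro span_minimal) (auto simp: E_def span_base)
  qed
  have "L \<inter> span E = int_span (insert d C)"
  proof
    show "int_span (insert d C) \<subseteq> L \<inter> span E"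
      using int_span_subset_lattice[OF L, of "insert d C"] int_span_subset_span[of "insert d C"]
        CL dL span_eq by auto
    show "L \<inter> span E \<subseteq> int_span (insert d C)"
    proof
      fix x assume x: "x \<in> L \<inter> span E"
      \<comment> \<open>Division with remainder by \<open>d\<close> in the
        \<open>b\<close>-coordinate: the remainder \<open>y\<close> has its
        \<open>b\<close>-coordinate in [0, \<open>f b d\<close>).\<close>
      define k where "k = \<lfloor>f b x / f b d\<rfloor>"
      define y where "y = x - of_int k *\<^sub>R d"
      have yL: "y \<in> L" "y \<in> span E"
        using x dL by (auto simp: y_def L intro!: lattice_diff lattice_of_int_scale span_diff span_scale)
      have fy: "f b y = f b x - k * f b d"
        by (simp add: y_def linear_diff[OF lin] linear_cmul[OF lin])
      have "of_int k \<le> f b x / f b d" "f b x / f b d < of_int k + 1"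
        unfolding k_def by linarith+
      then have fy0: "0 \<le> f b y" "f b y < f b d"
        using dL(3) by (auto simp: fy field_simps)
      \<comment> \<open>Subtracting \<open>w\<close> reduces the \<open>C\<close>-coordinates of
        \<open>y\<close> modulo 1 and keeps the \<open>b\<close>-coordinate. If that coordinate were
        nonzero, \<open>y - w\<close> would be a candidate in \<open>T\<close> smaller than
        \<open>d\<close>.\<close>
      define w where "w = (\<Sum>c\<in>C. of_int \<lfloor>f c y\<rfloor> *\<^sub>R c)"
      have wC: "w \<in> span C" unfolding w_def by (intro span_sum span_scale span_base)
      have wL: "w \<in> L" unfolding w_def using CL by (intro lattice_sum lattice_of_int_scale L) auto
      have fw: "f c w = \<lfloor>f c y\<rfloor>" if "c \<in> C" for c
      proof -
        have "f c w = (\<Sum>i\<in>C. of_int \<lfloor>f i y\<rfloor> * f c i)"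
          by (simp add: w_def linear_sum[OF lin] linear_cmul[OF lin])
        also have "\<dots> = (\<Sum>i\<in>C. if i = c then of_int \<lfloor>f i y\<rfloor> else 0)"
          using that by (intro sum.cong) (auto simp: val1 E_def)
        finally show ?thesis using that fin by simp
      qed
      have "f b y = 0"
      proof (rule ccontr)
        assume "f b y \<noteq> 0"
        moreover have "f b d \<le> 1" using d(1) by (simp add: T_def)
        moreover have "f b (y - w) = f b y" using fC0[OF wC] by (simp add: linear_diff[OF lin])
        moreover have "w \<in> span E" using wC span_mono[of C E] by (auto simp: E_def)
        moreover have "0 \<le> f c (y - w) \<and> f c (y - w) < 1" if "c \<in> C" for c
          using fw[OF that] by (simp add: linear_diff[OF lin]) linarith
        ultimately have "y - w \<in> T"
          using yL wL fy0 by (auto simp: T_def intro!: lattice_diff[OF L] span_diff)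
        then show False
          using d(2)[of "y - w"] fy0 \<open>f b (y - w) = f b y\<close> by simp
      qed
      then have "y = (\<Sum>c\<in>C. f c y *\<^sub>R c)"
        using rep[OF yL(2)] fin bC by (simp add: E_def)
      then have "y \<in> span C"
        by (metis (no_types, lifting) span_base span_scale span_sum)
      then obtain t :: "'a \<Rightarrow> int" where t: "y = (\<Sum>c\<in>C. of_int (t c) *\<^sub>R c)"
        using yL(1) C(2) unfolding int_span_def by blast
      have dC': "d \<notin> C" using dC span_base by blast
      have "x = y + of_int k *\<^sub>R d" by (simp add: y_def)
      also have "\<dots> = (\<Sum>c\<in>insert d C. of_int ((t(d := k)) c) *\<^sub>R c)"
        using fin dC' by (simp add: t) (intro sum.cong, auto)
      finally show "x \<in> int_span (insert d C)"
        unfolding int_span_def by blast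
    qed
  qed
  with dC span_eq show ?thesis using that by (simp add: E_def)
qed

text \<open>Induction along \<open>B\<close>: the new basis \<open>C\<close> need not contain
  \<open>B\<close>, only span the same subspace, and each further vector of \<open>B\<close> is
  replaced by the vector that \<open>int_span_extend\<close> provides.\<close>

lemma lattice_basis_of_span:
  fixes L :: "'a::euclidean_space set"
  assumes L: "euclidean_lattice L" and B: "independent B" "B \<subseteq> L"
  shows "\<exists>C. independent C \<and> span C = span B \<and> L \<inter> span B = int_span C"
proof -
  have "finite B" using B independent_imp_finite by blast
  then show ?thesis using B
  proof (induction B rule: finite_induct)
    case empty
    then show ?case
      using lattice_zero[OF L] by (intro exI[of _ "{}"]) (auto simp: int_span_def)
  next
    case (insert b B)
    then have b: "b \<notin> span B" "independent B" "b \<in> L" "B \<subseteq> L"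
      by (auto simp: independent_insert)
    then obtain C where C: "independent C" "span C = span B" "L \<inter> span B = int_span C"
      using insert.IH by blast
    have eq: "span (insert b C) = span (insert b B)"
      using C(2) by (simp add: span_insert)
    obtain d where d: "d \<notin> span C" "span (insert d C) = span (insert b C)"
      "L \<inter> span (insert b C) = int_span (insert d C)"
      using int_span_extend[OF L C(1), of b] C b by metis
    then show ?case
      using C(1) eq by (intro exI[of _ "insert d C"]) (auto simp: independent_insertI)
  qed
qed

text \<open>A maximal independent subset of \<open>L\<close> spans the whole space, so intersecting
  \<open>L\<close> with its span loses nothing. This makes the choice by \<open>SOME\<close> in
  \<open>lattice_det\<close> a choice of a true basis.\<close>

lemma full_lattice_basis:
  fixes L :: "'a::euclidean_space set"
  assumes L: "euclidean_lattice L" "dim L = DIM('a)"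
  obtains B where "lattice_basis B L" "span B = UNIV"
proof -
  obtain B where B: "B \<subseteq> L" "independent B" "L \<subseteq> span B" "card B = dim L"
    using basis_exists[of L] by metis
  have "span B = UNIV"
    using B L dim_eq_full dim_span_eq_card_independent by (metis dim_span)
  then show ?thesis
    using lattice_basis_of_span[OF L(1) B(2,1)] that by (auto simp: lattice_basis_def)
qed

section \<open>Fundamental domains and counting by volume\<close>

definition fundamental_domain :: "'a::euclidean_space set \<Rightarrow> 'a set \<Rightarrow> bool" where
  "fundamental_domain L D \<longleftrightarrow> D \<in> sets borel \<and> bounded D \<and> (\<forall>x. \<exists>!z. z \<in> L \<and> x - z \<in> D)"

text \<open>Splitting each coordinate into integer and fractional part moves a point into the cell,
  and the integer parts are the only possible choice.\<close>

lemma fundamental_domain_cell: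
  fixes B :: "'a::euclidean_space set"
  assumes B: "independent B" "span B = UNIV"
  shows "fundamental_domain (int_span B) (fundamental_cell B)"
proof -
  obtain f :: "'a \<Rightarrow> 'a \<Rightarrow> real"
    where f: "(\<forall>e. linear (f e)) \<and>
      (\<forall>e\<in>B. \<forall>t. f e (\<Sum>c\<in>B. t c *\<^sub>R c) = t e) \<and>
      (\<forall>x\<in>span B. (\<Sum>e\<in>B. f e x *\<^sub>R e) = x)"
    using dual_family[OF B(1)] ..
  note lin = f[THEN conjunct1, rule_format]
    and val = f[THEN conjunct2, THEN conjunct1, rule_format]
    and rep' = f[THEN conjunct2, THEN conjunct2, rule_format]
  have rep: "(\<Sum>e\<in>B. f e x *\<^sub>R e) = x" for x using rep' B by simp
  have fin: "finite B" using B independent_imp_finite by blast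
  have cell: "x \<in> fundamental_cell B \<longleftrightarrow> (\<forall>b\<in>B. 0 \<le> f b x \<and> f b x < 1)" for x
  proof
    assume "x \<in> fundamental_cell B"
    then show "\<forall>b\<in>B. 0 \<le> f b x \<and> f b x < 1"
      unfolding fundamental_cell_def using val by auto
  next
    assume "\<forall>b\<in>B. 0 \<le> f b x \<and> f b x < 1"
    then show "x \<in> fundamental_cell B"
      unfolding fundamental_cell_def using rep[of x, symmetric]
      by (intro CollectI exI[of _ "\<lambda>e. f e x"]) simp
  qed
  have [measurable]: "f b \<in> borel_measurable borel" for b
    using lin linear_continuous_on linear_conv_bounded_linear
    by (metis borel_measurable_continuous_onI)
  have "fundamental_cell B = {x \<in> space borel. \<forall>b\<in>B. 0 \<le> f b x \<and> f b x < 1}"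
    using cell by auto
  also have "\<dots> \<in> sets borel"
    using fin by measurable
  finally have borel: "fundamental_cell B \<in> sets borel" .
  have bdd: "bounded (fundamental_cell B)"
    by (rule bounded_subset[OF bounded_bounded_combinations[of B]])
      (force simp: fundamental_cell_def)
  have "\<exists>!z. z \<in> int_span B \<and> x - z \<in> fundamental_cell B" for x
  proof
    let ?z = "\<Sum>b\<in>B. of_int \<lfloor>f b x\<rfloor> *\<^sub>R b"
    have "f b (x - ?z) = f b x - of_int \<lfloor>f b x\<rfloor>" if "b \<in> B" for b
      using val[OF that, of "\<lambda>b. of_int \<lfloor>f b x\<rfloor>"] by (simp add: linear_diff[OF lin])
    then have "x - ?z \<in> fundamental_cell B"
      unfolding cell by auto linarith
    then show "?z \<in> int_span B \<and> x - ?z \<in> fundamental_cell B"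
      by (auto simp: int_span_def)
    fix z assume z: "z \<in> int_span B \<and> x - z \<in> fundamental_cell B"
    then obtain c :: "'a \<Rightarrow> int" where c: "z = (\<Sum>b\<in>B. of_int (c b) *\<^sub>R b)"
      by (auto simp: int_span_def)
    have "c b = \<lfloor>f b x\<rfloor>" if "b \<in> B" for b
    proof -
      have "f b (x - z) = f b x - of_int (c b)"
        using val[OF that, of "\<lambda>b. of_int (c b)"] by (simp add: c linear_diff[OF lin])
      moreover have "0 \<le> f b (x - z)" "f b (x - z) < 1" using z cell that by auto
      ultimately show ?thesis by linarith
    qed
    then show "z = ?z" by (simp add: c)
  qed
  with borel bdd show ?thesis by (simp add: fundamental_domain_def)
qed

text \<open>Hides the chosen basis: from here on the determinant enters only as the volume of some
  fundamental domain, taken in the Borel measure \<open>lborel\<close>.\<close>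

lemma lattice_det_fundamental_domain:
  fixes L :: "'a::euclidean_space set"
  assumes L: "euclidean_lattice L" "dim L = DIM('a)"
  obtains D where "fundamental_domain L D" "lattice_det L = measure lborel D"
proof -
  define B where "B = (SOME B. lattice_basis B L)"
  have B: "lattice_basis B L"
    unfolding B_def using full_lattice_basis[OF L] by (metis someI)
  have ind: "independent B" and LB: "L = int_span B" using B by (auto simp: lattice_basis_def)
  have "L \<subseteq> span B"
    unfolding LB by (rule int_span_subset_span)
  then have "dim (span B) = DIM('a)"
    using dim_subset[of L "span B"] L dim_subset_UNIV[of "span B"] by simp
  then have "span B = UNIV" using dim_eq_full by (metis dim_span)
  then have fd: "fundamental_domain L (fundamental_cell B)"
    using fundamental_domain_cell[OF ind] LB by simp
  then have "lattice_det L = measure lborel (fundamental_cell B)"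
    by (simp add: lattice_det_def B_def fundamental_domain_def)
  with fd show ?thesis by (rule that)
qed

text \<open>Unfolding: \<open>S\<close> is cut along the translates of \<open>D\<close> and the pieces are moved back to \<open>D\<close>.\<close>
lemma emeasure_fundamental_domain:
  fixes L :: "'a::euclidean_space set"
  assumes L: "countable L" and D: "fundamental_domain L D" and S: "S \<in> sets borel"
  shows "emeasure lborel S =
    (\<integral>\<^sup>+x. emeasure (count_space L) {z\<in>L. x + z \<in> S} * indicator D x \<partial>lborel)"
proof -
  have [measurable]: "D \<in> sets borel" "S \<in> sets borel"
    using D S by (auto simp: fundamental_domain_def)
  have "S = (\<Union>z\<in>L. {x. x \<in> S \<and> x - z \<in> D})"
    using D by (fastforce simp: fundamental_domain_def)
  then have "emeasure lborel S = emeasure lborel (\<Union>z\<in>L. {x. x \<in> S \<and> x - z \<in> D})" by simp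
  also have "\<dots> = (\<integral>\<^sup>+z. emeasure lborel {x. x \<in> S \<and> x - z \<in> D} \<partial>count_space L)"
    using D L by (intro emeasure_UN_countable)
      (auto simp: disjoint_family_on_def fundamental_domain_def)
  also have "\<dots> = (\<integral>\<^sup>+z. (\<integral>\<^sup>+x. indicator S (x + z) * indicator D x \<partial>lborel) \<partial>count_space L)"
  proof (rule nn_integral_cong)
    fix z
    have "emeasure lborel {x. x \<in> S \<and> x - z \<in> D} =
        (\<integral>\<^sup>+x. indicator {x. x \<in> S \<and> x - z \<in> D} x \<partial>lborel)"
      by (subst nn_integral_indicator) auto
    also have "\<dots> = (\<integral>\<^sup>+x. indicator {x. x \<in> S \<and> x - z \<in> D} x \<partial>distr lborel borel ((+) z))"
      by (simp add: lborel_distr_plus)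
    also have "\<dots> = (\<integral>\<^sup>+x. indicator {x. x \<in> S \<and> x - z \<in> D} (z + x) \<partial>lborel)"
      by (subst nn_integral_distr) auto
    also have "\<dots> = (\<integral>\<^sup>+x. indicator S (x + z) * indicator D x \<partial>lborel)"
      by (intro nn_integral_cong) (auto simp: indicator_def add.commute)
    finally show "emeasure lborel {x. x \<in> S \<and> x - z \<in> D} =
      (\<integral>\<^sup>+x. indicator S (x + z) * indicator D x \<partial>lborel)" .
  qed
  also have "\<dots> = (\<integral>\<^sup>+x. (\<integral>\<^sup>+z. indicator S (x + z) * indicator D x \<partial>count_space L) \<partial>lborel)"
    by (rule nn_integral_count_space_nn_integral[OF L, symmetric]) simp
  also have "\<dots> = (\<integral>\<^sup>+x. emeasure (count_space L) {z\<in>L. x + z \<in> S} * indicator D x \<partial>lborel)"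
  proof (rule nn_integral_cong)
    fix x
    have "(\<integral>\<^sup>+z. indicator S (x + z) * indicator D x \<partial>count_space L) =
        (\<integral>\<^sup>+z. indicator {z\<in>L. x + z \<in> S} z * indicator D x \<partial>count_space L)"
      by (intro nn_integral_cong) (auto simp: indicator_def)
    also have "\<dots> = emeasure (count_space L) {z\<in>L. x + z \<in> S} * indicator D x"
      by (subst nn_integral_multc) auto
    finally show "(\<integral>\<^sup>+z. indicator S (x + z) * indicator D x \<partial>count_space L) =
      emeasure (count_space L) {z\<in>L. x + z \<in> S} * indicator D x" .
  qed
  finally show ?thesis .
qed

text \<open>Blichfeldt's averaging principle: the volume of \<open>S\<close> is the integral over
  \<open>D\<close> of the number of points of \<open>x + L\<close> in \<open>S\<close>, so a
  pointwise bound on that number bounds the volume.\<close>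

lemma emeasure_le_lattice_count:
  fixes L :: "'a::euclidean_space set"
  assumes L: "countable L" and D: "fundamental_domain L D" and S: "S \<in> sets borel"
    and N: "\<And>x. finite {z\<in>L. x + z \<in> S} \<and> card {z\<in>L. x + z \<in> S} \<le> N"
  shows "emeasure lborel S \<le> of_nat N * emeasure lborel D"
proof -
  have [measurable]: "D \<in> sets borel" using D by (simp add: fundamental_domain_def)
  have "emeasure lborel S \<le> (\<integral>\<^sup>+x. of_nat N * indicator D x \<partial>lborel)"
    unfolding emeasure_fundamental_domain[OF L D S]
    using N by (intro nn_integral_mono mult_right_mono) (auto simp: emeasure_count_space_finite)
  also have "\<dots> = of_nat N * emeasure lborel D"
    by (subst nn_integral_cmult_indicator) auto
  finally show ?thesis .
qed

lemma emeasure_ge_lattice_count: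
  fixes L :: "'a::euclidean_space set"
  assumes L: "countable L" and D: "fundamental_domain L D" and S: "S \<in> sets borel"
    and N: "\<And>x. finite {z\<in>L. x + z \<in> S} \<and> N \<le> card {z\<in>L. x + z \<in> S}"
  shows "of_nat N * emeasure lborel D \<le> emeasure lborel S"
proof -
  have [measurable]: "D \<in> sets borel" using D by (simp add: fundamental_domain_def)
  have "of_nat N * emeasure lborel D = (\<integral>\<^sup>+x. of_nat N * indicator D x \<partial>lborel)"
    by (subst nn_integral_cmult_indicator) auto
  also have "\<dots> \<le> emeasure lborel S"
    unfolding emeasure_fundamental_domain[OF L D S]
    using N by (intro nn_integral_mono mult_right_mono) (auto simp: emeasure_count_space_finite)
  finally show ?thesis .
qed

lemma emeasure_fundamental_domain_finite:
  "fundamental_domain L D \<Longrightarrow> emeasure lborel D < \<infinity>"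
  using emeasure_bounded_finite[of D] by (simp add: fundamental_domain_def)

text \<open>Were \<open>D\<close> a null set, unfolding with \<open>S = UNIV\<close> would give the
  whole space measure zero.\<close>

lemma measure_fundamental_domain_pos:
  fixes L :: "'a::euclidean_space set"
  assumes L: "countable L" and D: "fundamental_domain L D"
  shows "measure lborel D > 0"
proof -
  have [measurable]: "D \<in> sets borel" using D by (simp add: fundamental_domain_def)
  have "emeasure lborel D \<noteq> 0"
  proof
    assume "emeasure lborel D = 0"
    then have "AE x in lborel. x \<notin> D"
      by (intro AE_not_in) (auto simp: null_sets_def)
    then have "emeasure lborel (UNIV :: 'a set) = (\<integral>\<^sup>+(x::'a). 0 \<partial>lborel)"
      unfolding emeasure_fundamental_domain[OF L D space_in_borel]
      by (intro nn_integral_cong_AE) (auto elim!: eventually_mono simp: indicator_def)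
    then show False by simp
  qed
  then show ?thesis
    using emeasure_fundamental_domain_finite[OF D]
    by (simp add: measure_def enn2real_positive_iff zero_less_iff_neq_zero)
qed

section \<open>Cosets of a sublattice\<close>

text \<open>\<open>X\<close> may be any set, because this is also applied to the union of the
  sublattices, which is in general not a group.\<close>

definition cosets :: "'a::euclidean_space set \<Rightarrow> 'a set \<Rightarrow> 'a set set" where
  "cosets M X = (\<lambda>x. (+) x ` M) ` X"

lemma coset_eq_iff:
  assumes M: "euclidean_lattice M"
  shows "(+) x ` M = (+) y ` M \<longleftrightarrow> x - y \<in> M"
proof
  assume "(+) x ` M = (+) y ` M"
  moreover have "x \<in> (+) x ` M" using lattice_zero[OF M] by force
  ultimately show "x - y \<in> M" by auto
next
  have sub: "(+) x ` M \<subseteq> (+) y ` M" if "x - y \<in> M" for x y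
  proof
    fix v assume "v \<in> (+) x ` M"
    then obtain m where "m \<in> M" "v = x + m" by blast
    then have "v = y + ((x - y) + m)" "(x - y) + m \<in> M"
      using that lattice_add[OF M] by auto
    then show "v \<in> (+) y ` M" by blast
  qed
  assume "x - y \<in> M"
  moreover from this have "y - x \<in> M" using lattice_minus[OF M] by fastforce
  ultimately show "(+) x ` M = (+) y ` M" using sub by blast
qed

text \<open>Subtracting a suitable element of \<open>M\<close> brings any \<open>x + y\<close> into
  \<open>D\<close> without changing the coset of \<open>y\<close>. Hence each translate of
  \<open>L\<close> meets \<open>D\<close> in at least as many points as there are cosets.\<close>

lemma cosets_subset_image:
  assumes L: "euclidean_lattice L" and M: "euclidean_lattice M" "M \<subseteq> L"
    and D: "fundamental_domain M D"
  shows "cosets M L \<subseteq> (\<lambda>z. (+) z ` M) ` {z\<in>L. x + z \<in> D}"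
proof
  fix Q assume "Q \<in> cosets M L"
  then obtain y where y: "y \<in> L" "Q = (+) y ` M" by (auto simp: cosets_def)
  obtain m where m: "m \<in> M" "x + y - m \<in> D"
    using D unfolding fundamental_domain_def by blast
  have "y - m \<in> {z\<in>L. x + z \<in> D}"
    using m M y lattice_diff[OF L] by (auto simp: add_diff_eq)
  moreover have "Q = (+) (y - m) ` M"
    using m y coset_eq_iff[OF M(1), of y "y - m"] by simp
  ultimately show "Q \<in> (\<lambda>z. (+) z ` M) ` {z\<in>L. x + z \<in> D}" by blast
qed

lemma finite_lattice_translate:
  assumes "euclidean_lattice L" "bounded S"
  shows "finite {z\<in>L. x + z \<in> S}"
proof -
  have "{z\<in>L. x + z \<in> S} \<subseteq> L \<inter> (\<lambda>y. y - x) ` S"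
    by (auto simp: image_iff intro!: bexI[of _ "x + _"])
  then show ?thesis
    using finite_lattice_Int_bounded[OF assms(1) bounded_translation_minus[OF assms(2)]]
    by (rule finite_subset)
qed

lemma finite_cosets:
  fixes L M :: "'a::euclidean_space set"
  assumes L: "euclidean_lattice L" and M: "euclidean_lattice M" "M \<subseteq> L" "dim M = DIM('a)"
  shows "finite (cosets M L)"
proof -
  obtain D where D: "fundamental_domain M D"
    using lattice_det_fundamental_domain[OF M(1,3)] by blast
  then have "finite {z\<in>L. 0 + z \<in> D}"
    by (intro finite_lattice_translate[OF L]) (simp add: fundamental_domain_def)
  then show ?thesis
    using cosets_subset_image[OF L M(1,2) D, of 0] by (meson finite_imageI finite_subset)
qed

lemma lattice_det_pos:
  fixes L :: "'a::euclidean_space set"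
  assumes "euclidean_lattice L" "dim L = DIM('a)"
  shows "lattice_det L > 0"
  using lattice_det_fundamental_domain[OF assms]
    measure_fundamental_domain_pos[OF countable_lattice[OF assms(1)]] by metis

text \<open>Each translate of \<open>L\<close> has at least one point per coset of \<open>M\<close>
  in the domain \<open>D\<close> of \<open>M\<close>; averaging over a domain \<open>E\<close> of
  \<open>L\<close> turns this into a comparison of volumes.\<close>

lemma card_cosets_le_det_ratio:
  fixes L M :: "'a::euclidean_space set"
  assumes L: "euclidean_lattice L" "dim L = DIM('a)"
    and M: "euclidean_lattice M" "M \<subseteq> L" "dim M = DIM('a)"
  shows "real (card (cosets M L)) \<le> lattice_det M / lattice_det L"
proof -
  obtain D where D: "fundamental_domain M D" "lattice_det M = measure lborel D"
    using lattice_det_fundamental_domain[OF M(1,3)] by blast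
  obtain E where E: "fundamental_domain L E" "lattice_det L = measure lborel E"
    using lattice_det_fundamental_domain[OF L] by blast
  have "of_nat (card (cosets M L)) * emeasure lborel E \<le> emeasure lborel D"
  proof (rule emeasure_ge_lattice_count[OF countable_lattice[OF L(1)] E(1)])
    show "D \<in> sets borel" using D by (simp add: fundamental_domain_def)
    fix x
    have fin: "finite {z\<in>L. x + z \<in> D}"
      using D by (intro finite_lattice_translate[OF L(1)]) (simp add: fundamental_domain_def)
    with cosets_subset_image[OF L(1) M(1,2) D(1), of x]
    show "finite {z\<in>L. x + z \<in> D} \<and> card (cosets M L) \<le> card {z\<in>L. x + z \<in> D}"
      using surj_card_le by blast
  qed
  moreover have "emeasure lborel E = ennreal (lattice_det L)"
    using emeasure_fundamental_domain_finite[OF E(1)] E(2)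
    by (simp add: emeasure_eq_ennreal_measure)
  moreover have "emeasure lborel D = ennreal (lattice_det M)"
    using emeasure_fundamental_domain_finite[OF D(1)] D(2)
    by (simp add: emeasure_eq_ennreal_measure)
  ultimately have "ennreal (real (card (cosets M L)) * lattice_det L) \<le> ennreal (lattice_det M)"
    by (simp add: ennreal_mult'' ennreal_of_nat_eq_real_of_nat lattice_det_pos[OF L] less_imp_le)
  then show ?thesis
    using lattice_det_pos[OF L] lattice_det_pos[OF M(1,3)]
    by (simp add: pos_le_divide_eq)
qed

section \<open>Full rank of the intersection lattice\<close>

lemma full_sublattice_multiple:
  fixes L M :: "'a::euclidean_space set"
  assumes L: "euclidean_lattice L" and M: "euclidean_lattice M" "M \<subseteq> L" "dim M = DIM('a)"
  shows "\<exists>q::nat. q > 0 \<and> (\<forall>z\<in>L. real q *\<^sub>R z \<in> M)"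
proof (intro exI conjI ballI)
  let ?N = "card (cosets M L)"
  fix z assume z: "z \<in> L"
  \<comment> \<open>Pigeonhole: the \<open>?N + 1\<close> multiples of \<open>z\<close> with factors
    0 to \<open>?N\<close> fall into at most \<open>?N\<close> cosets.\<close>
  have "(\<lambda>j. (+) (real j *\<^sub>R z) ` M) ` {..?N} \<subseteq> cosets M L"
    using lattice_of_nat_scale[OF L z] by (auto simp: cosets_def)
  then have "card ((\<lambda>j. (+) (real j *\<^sub>R z) ` M) ` {..?N}) \<le> ?N"
    by (rule card_mono[OF finite_cosets[OF L M]])
  then have "\<not> inj_on (\<lambda>j. (+) (real j *\<^sub>R z) ` M) {..?N}"
    by (intro pigeonhole) simp
  then obtain i j where ij: "i \<le> ?N" "j \<le> ?N" "i < j"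
    "(+) (real i *\<^sub>R z) ` M = (+) (real j *\<^sub>R z) ` M"
    unfolding inj_on_def by (metis atMost_iff linorder_neqE_nat)
  then have "real j *\<^sub>R z - real i *\<^sub>R z \<in> M"
    using coset_eq_iff[OF M(1)] by metis
  then have jz: "real (j - i) *\<^sub>R z \<in> M"
    using ij by (simp add: of_nat_diff algebra_simps)
  \<comment> \<open>The factor \<open>j - i\<close> depends on \<open>z\<close> but is at most
    \<open>?N\<close>, so the factorial is a multiplier common to all \<open>z\<close>.\<close>
  have "j - i dvd fact ?N"
    using ij by (intro dvd_fact) auto
  then obtain c :: nat where c: "fact ?N = (j - i) * c" by (elim dvdE)
  show "real (fact ?N) *\<^sub>R z \<in> M"
    using lattice_of_nat_scale[OF M(1) jz, of c] by (simp add: c mult.commute del: of_nat_fact)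
qed simp

lemma dim_full_multiple:
  fixes L M :: "'a::euclidean_space set"
  assumes "q > 0" "\<forall>z\<in>L. real q *\<^sub>R z \<in> M"
  shows "dim L \<le> dim M"
proof (rule dim_mono)
  show "L \<subseteq> span M"
  proof
    fix z assume "z \<in> L"
    then have "(1 / real q) *\<^sub>R (real q *\<^sub>R z) \<in> span M"
      using assms by (intro span_scale span_base) auto
    then show "z \<in> span M" using assms by simp
  qed
qed

lemma lattice_INT:
  assumes "I \<noteq> {}" "\<And>i. i \<in> I \<Longrightarrow> euclidean_lattice (M i)"
  shows "euclidean_lattice (\<Inter>i\<in>I. M i)"
proof -
  obtain i where "i \<in> I" using assms by blast
  then have "discrete (\<Inter>i\<in>I. M i)"
    using assms(2)[of i] discrete_subset[of "M i" "\<Inter>i\<in>I. M i"] by (auto simp: euclidean_lattice_def)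
  then show ?thesis
    using assms(2) by (simp add: euclidean_lattice_def)
qed

text \<open>Multipliers carrying \<open>L\<close> into the single lattices are multiplied together;
  the product carries \<open>L\<close> into the intersection, which therefore spans as much as
  \<open>L\<close> does.\<close>

lemma dim_INT_full:
  fixes L :: "'a::euclidean_space set" and M :: "'i \<Rightarrow> 'a set"
  assumes L: "euclidean_lattice L" "dim L = DIM('a)" and I: "finite I"
    and M: "\<And>i. i \<in> I \<Longrightarrow> euclidean_lattice (M i) \<and> dim (M i) = DIM('a) \<and> M i \<subseteq> L"
  shows "dim (\<Inter>i\<in>I. M i) = DIM('a)"
proof -
  have "\<exists>q::nat. q > 0 \<and> (\<forall>z\<in>L. real q *\<^sub>R z \<in> (\<Inter>i\<in>I. M i))"
    using I M
  proof (induction I rule: finite_induct)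
    case empty
    then show ?case by (intro exI[of _ 1]) auto
  next
    case (insert i I)
    then obtain q :: nat where q: "q > 0" "\<forall>z\<in>L. real q *\<^sub>R z \<in> (\<Inter>i\<in>I. M i)"
      by (metis insertCI)
    have Mi: "euclidean_lattice (M i)" "M i \<subseteq> L" "dim (M i) = DIM('a)"
      using insert.prems by auto
    obtain p :: nat where p: "p > 0" "\<forall>z\<in>L. real p *\<^sub>R z \<in> M i"
      using full_sublattice_multiple[OF L(1) Mi] by blast
    have "real (p * q) *\<^sub>R z \<in> M j" if "z \<in> L" "j \<in> insert i I" for z j
    proof (cases "j = i")
      case True
      then show ?thesis
        using lattice_of_nat_scale[OF Mi(1), of "real p *\<^sub>R z" q] p that by (simp add: mult.commute)
    next
      case False
      then show ?thesis
        using lattice_of_nat_scale[of "M j" "real q *\<^sub>R z" p] q that insert.prems by simp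
    qed
    then show ?case using p q by (intro exI[of _ "p * q"]) auto
  qed
  then have "dim L \<le> dim (\<Inter>i\<in>I. M i)"
    using dim_full_multiple by blast
  then show ?thesis
    using L(2) dim_subset_UNIV[of "\<Inter>i\<in>I. M i"] by simp
qed

section \<open>Counting cosets in a union and points of a translate\<close>

text \<open>The zero coset is common to all \<open>\<Lambda> i\<close>, so it is counted only once.\<close>
lemma card_cosets_UN_le:
  fixes L M :: "'a::euclidean_space set" and \<Lambda> :: "'i \<Rightarrow> 'a set"
  assumes I: "finite I"
    and fin: "\<And>i. i \<in> I \<Longrightarrow> 0 \<in> \<Lambda> i \<and> finite (cosets M (\<Lambda> i))"
  shows "finite (cosets M (\<Union>i\<in>I. \<Lambda> i)) \<and>
    card (cosets M (\<Union>i\<in>I. \<Lambda> i)) \<le> 1 + (\<Sum>i\<in>I. card (cosets M (\<Lambda> i)) - 1)"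
proof -
  have sub: "cosets M (\<Union>i\<in>I. \<Lambda> i) \<subseteq> insert M (\<Union>i\<in>I. cosets M (\<Lambda> i) - {M})"
    by (auto simp: cosets_def)
  have fin': "finite (insert M (\<Union>i\<in>I. cosets M (\<Lambda> i) - {M}))"
    using I fin by auto
  have "(+) 0 ` M \<in> cosets M (\<Lambda> i)" if "i \<in> I" for i
    using fin[OF that] unfolding cosets_def by blast
  then have "card (cosets M (\<Lambda> i) - {M}) = card (cosets M (\<Lambda> i)) - 1" if "i \<in> I" for i
    using that by simp
  then have "card (\<Union>i\<in>I. cosets M (\<Lambda> i) - {M}) \<le> (\<Sum>i\<in>I. card (cosets M (\<Lambda> i)) - 1)"
    using card_UN_le[OF I, of "\<lambda>i. cosets M (\<Lambda> i) - {M}"] by simp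
  moreover have "card (cosets M (\<Union>i\<in>I. \<Lambda> i)) \<le> card (insert M (\<Union>i\<in>I. cosets M (\<Lambda> i) - {M}))"
    by (rule card_mono[OF fin' sub])
  moreover have "card (insert M (\<Union>i\<in>I. cosets M (\<Lambda> i) - {M})) \<le>
      Suc (card (\<Union>i\<in>I. cosets M (\<Lambda> i) - {M}))"
    by (rule card_insert_le_m1) auto
  ultimately show ?thesis
    using finite_subset[OF sub fin'] by linarith
qed

text \<open>Fix one point \<open>x + w\<close> of the translate in \<open>S\<close>. Differences to
  it lie in \<open>U\<close>, and two of them in the same coset of \<open>M\<close> come from equal
  points, so the points are counted by the cosets of \<open>M\<close> in \<open>U\<close>.\<close>

lemma card_translate_le_cosets:
  assumes M: "euclidean_lattice M" and U: "finite (cosets M U)"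
    and inj: "\<And>a b. a \<in> S \<Longrightarrow> b \<in> S \<Longrightarrow> a - b \<in> M \<Longrightarrow> a = b"
    and diff: "\<And>a b. a \<in> S \<Longrightarrow> b \<in> S \<Longrightarrow> a - b \<in> L \<Longrightarrow> a - b \<in> U"
    and L: "euclidean_lattice L"
  shows "finite {z\<in>L. x + z \<in> S} \<and> card {z\<in>L. x + z \<in> S} \<le> card (cosets M U)"
proof (cases "{z\<in>L. x + z \<in> S} = {}")
  case True
  show ?thesis unfolding True by simp
next
  case False
  then obtain w where w: "w \<in> L" "x + w \<in> S" by blast
  let ?g = "\<lambda>z. (+) (z - w) ` M"
  have "inj_on ?g {z\<in>L. x + z \<in> S}"
  proof (rule inj_onI)
    fix a b assume "a \<in> {z\<in>L. x + z \<in> S}" "b \<in> {z\<in>L. x + z \<in> S}" "?g a = ?g b"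
    then show "a = b"
      using coset_eq_iff[OF M, of "a - w" "b - w"] inj[of "x + a" "x + b"] by auto
  qed
  moreover have "?g ` {z\<in>L. x + z \<in> S} \<subseteq> cosets M U"
  proof
    fix Q assume "Q \<in> ?g ` {z\<in>L. x + z \<in> S}"
    then obtain z where z: "z \<in> L" "x + z \<in> S" "Q = ?g z" by blast
    then have "z - w \<in> U"
      using diff[of "x + z" "x + w"] w lattice_diff[OF L] by auto
    then show "Q \<in> cosets M U" using z by (auto simp: cosets_def)
  qed
  ultimately show ?thesis
    using U by (meson card_inj_on_le inj_on_finite)
qed

section \<open>Successive minima\<close>

context
  fixes K :: "'a::euclidean_space set"
  assumes K: "symmetric_convex_body K" "interior K \<noteq> {}"
begin

lemma body_zero_interior: "0 \<in> interior K"
proof -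
  obtain x where x: "x \<in> interior K" using K by blast
  have "uminus ` interior K = interior K"
    using K interior_negations[of K] by (simp add: symmetric_convex_body_def)
  then have "- x \<in> interior K" using x by blast
  moreover have "convex (interior K)"
    using K by (simp add: symmetric_convex_body_def convex_interior)
  ultimately have "(1/2) *\<^sub>R x + (1/2) *\<^sub>R (- x) \<in> interior K"
    using x by (intro convexD) auto
  then show ?thesis by simp
qed

lemma body_scale_minus: "x \<in> (*\<^sub>R) l ` K \<Longrightarrow> - x \<in> (*\<^sub>R) l ` K"
  using K by (force simp: symmetric_convex_body_def)

text \<open>The triangle inequality for the gauge of \<open>K\<close>, expressed by dilates: the sum
  is \<open>l + m\<close> times a convex combination.\<close>

lemma body_scale_add:
  assumes "x \<in> (*\<^sub>R) l ` K" "y \<in> (*\<^sub>R) m ` K" "0 \<le> l" "0 \<le> m"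
  shows "x + y \<in> (*\<^sub>R) (l + m) ` K"
proof (cases "l + m = 0")
  case True
  then have "l = 0" "m = 0" using assms by auto
  then show ?thesis using assms by force
next
  case False
  obtain u v where uv: "u \<in> K" "v \<in> K" "x = l *\<^sub>R u" "y = m *\<^sub>R v" using assms by blast
  have "(l / (l + m)) *\<^sub>R u + (m / (l + m)) *\<^sub>R v \<in> K"
    using K uv assms False
    by (intro convexD) (auto simp: symmetric_convex_body_def simp flip: add_divide_distrib)
  moreover have "x + y = (l + m) *\<^sub>R ((l / (l + m)) *\<^sub>R u + (m / (l + m)) *\<^sub>R v)"
    using False by (simp only: uv scaleR_right_distrib scaleR_scaleR) simp
  ultimately show ?thesis by blast
qed

lemma body_absorbing:
  obtains l where "0 \<le> l" "x \<in> (*\<^sub>R) l ` K"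
proof (cases "x = 0")
  case True
  then show ?thesis using that[of 0] body_zero_interior interior_subset by force
next
  case False
  obtain e where e: "e > 0" "ball 0 e \<subseteq> K"
    using body_zero_interior by (meson mem_interior)
  have "(e / (2 * norm x)) *\<^sub>R x \<in> K"
    using e False by (intro subsetD[OF e(2)]) simp
  moreover have "x = (2 * norm x / e) *\<^sub>R ((e / (2 * norm x)) *\<^sub>R x)"
    using e False by simp
  ultimately show ?thesis
    using that[of "2 * norm x / e"] e by (metis divide_nonneg_pos imageI mult_nonneg_nonneg norm_ge_zero zero_le_numeral)
qed

text \<open>Converts openness into a strictly smaller factor, which later contradicts the minimality
  of a successive minimum.\<close>

lemma body_scale_interior:
  assumes "x \<in> (*\<^sub>R) r ` interior K" "r > 0"
  obtains l where "0 \<le> l" "l < r" "x \<in> (*\<^sub>R) l ` K"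
proof -
  obtain k where k: "k \<in> interior K" "x = r *\<^sub>R k" using assms by blast
  obtain e where e: "e > 0" "ball k e \<subseteq> K"
    using k by (meson mem_interior)
  \<comment> \<open>Chosen so that \<open>(1 + d)\<close> times \<open>k\<close> is still within
    distance \<open>e\<close> of \<open>k\<close>.\<close>
  define d where "d = e / (norm k + 1)"
  have pos: "0 < norm k + 1" by (simp add: add_nonneg_pos)
  have d: "d > 0" using e pos by (simp add: d_def)
  have "d * norm k < e"
    using e pos by (simp add: d_def pos_divide_less_eq distrib_left)
  then have "(1 + d) *\<^sub>R k \<in> K"
    using d by (intro subsetD[OF e(2)]) (simp add: dist_norm scaleR_left_distrib)
  moreover have "x = (r / (1 + d)) *\<^sub>R ((1 + d) *\<^sub>R k)"
    using d by (simp add: k)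
  moreover have "0 \<le> r / (1 + d)" "r / (1 + d) < r"
    using d assms by (auto simp: field_simps)
  ultimately show ?thesis using that by blast
qed

text \<open>Compactness shows that the \<open>LEAST\<close> is attained. Assuming only uniform
  discreteness of \<open>X\<close> covers both a lattice and a lattice with sublattices
  removed.\<close>

lemma successive_min_one:
  assumes X: "uniform_discrete X" "\<not> X \<subseteq> {0}"
  shows "0 < successive_min 1 K X"
    and "\<exists>x\<in>X. x \<noteq> 0 \<and> x \<in> (*\<^sub>R) (successive_min 1 K X) ` K"
    and "\<And>l x. x \<in> X \<Longrightarrow> x \<noteq> 0 \<Longrightarrow> 0 \<le> l \<Longrightarrow> x \<in> (*\<^sub>R) l ` K \<Longrightarrow> successive_min 1 K X \<le> l"
proof -
  define P where "P l \<longleftrightarrow> 0 \<le> l \<and> (\<exists>x\<in>X. x \<noteq> 0 \<and> x \<in> (*\<^sub>R) l ` K)" for l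
  have dim1: "1 \<le> dim S \<longleftrightarrow> (\<exists>x\<in>S. x \<noteq> 0)" for S :: "'a set"
    using dim_eq_0[of S] by (metis One_nat_def Suc_leI gr0I insertCI not_one_le_zero singletonD subsetI subset_iff)
  have sm: "successive_min 1 K X = (LEAST l. P l)"
    unfolding successive_min_def dim1 P_def by (rule arg_cong[of _ _ Least]) auto
  obtain l1 where l1: "P l1"
    using X(2) body_absorbing unfolding P_def by (metis insertI1 subsetI)
  \<comment> \<open>The admissible factors up to one known admissible \<open>l1\<close>, written as
    a projection of a set of pairs so that compactness can be read off.\<close>
  define A where "A = fst ` (({0..l1} \<times> K) \<inter> {p. fst p *\<^sub>R snd p \<in> X - {0}})"
  have A: "l \<in> A \<longleftrightarrow> P l \<and> l \<le> l1" for l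
  proof
    assume "l \<in> A"
    then obtain u where "0 \<le> l" "l \<le> l1" "u \<in> K" "l *\<^sub>R u \<in> X" "l *\<^sub>R u \<noteq> 0"
      by (auto simp: A_def)
    then show "P l \<and> l \<le> l1" unfolding P_def by blast
  next
    assume "P l \<and> l \<le> l1"
    then obtain u where "0 \<le> l" "l \<le> l1" "u \<in> K" "l *\<^sub>R u \<in> X" "l *\<^sub>R u \<noteq> 0"
      unfolding P_def by blast
    then have "(l, u) \<in> ({0..l1} \<times> K) \<inter> {p. fst p *\<^sub>R snd p \<in> X - {0}}" by simp
    then show "l \<in> A" unfolding A_def by (rule image_eqI[rotated]) simp
  qed
  \<comment> \<open>Discreteness makes being a nonzero point of \<open>X\<close> a closed
    condition.\<close>
  have "closed (X - {0})"
    by (intro uniform_discrete_imp_closed uniform_discrete_subset[OF X(1)]) auto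
  then have "closed ((\<lambda>p::real \<times> 'a. fst p *\<^sub>R snd p) -` (X - {0}))"
    by (rule closed_vimage) (intro continuous_intros)
  then have "compact (({0..l1} \<times> K) \<inter> {p. fst p *\<^sub>R snd p \<in> X - {0}})"
    using K by (intro compact_Int_closed compact_Times)
      (auto simp: symmetric_convex_body_def vimage_def)
  then have "compact A"
    unfolding A_def by (intro compact_continuous_image continuous_intros)
  moreover have "A \<noteq> {}" using A[of l1] l1 by blast
  ultimately obtain m where m: "m \<in> A" "\<forall>l\<in>A. m \<le> l"
    using compact_attains_inf[of A] by blast
  have min: "m \<le> l" if "P l" for l
  proof (cases "l \<le> l1")
    case True
    then show ?thesis using A m(2) that by blast
  next
    case False
    then show ?thesis using A[of m] m(1) by linarith
  qed
  have "P m" using m A by blast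
  then have eq: "successive_min 1 K X = m"
    unfolding sm using min by (rule Least_equality)
  show "\<exists>x\<in>X. x \<noteq> 0 \<and> x \<in> (*\<^sub>R) (successive_min 1 K X) ` K"
    using \<open>P m\<close> unfolding eq P_def by blast
  show "0 < successive_min 1 K X"
  proof -
    have "m \<noteq> 0" using \<open>P m\<close> unfolding P_def by force
    then show ?thesis using \<open>P m\<close> unfolding eq P_def by simp
  qed
  show "successive_min 1 K X \<le> l" if "x \<in> X" "x \<noteq> 0" "0 \<le> l" "x \<in> (*\<^sub>R) l ` K" for l x
    using min[of l] that unfolding eq P_def by blast
qed

end

section \<open>Volumes and the packing along a segment\<close>

lemma emeasure_disjoint_translates:
  fixes V :: "'a::euclidean_space set" and v :: "nat \<Rightarrow> 'a"
  assumes V: "open V" "emeasure lborel V = ennreal c" and "0 \<le> c"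
    and disj: "\<And>i j x y. i < k \<Longrightarrow> j < k \<Longrightarrow> x \<in> V \<Longrightarrow> y \<in> V \<Longrightarrow> v i + x = v j + y \<Longrightarrow> i = j"
  shows "emeasure lborel (\<Union>j<k. (+) (v j) ` V) = ennreal (real k * c)"
proof -
  have open_V: "open ((+) (v j) ` V)" for j
    using V(1) by (rule open_translation)
  have "emeasure lborel ((+) (v j) ` V) = ennreal c" for j
  proof -
    have "emeasure lebesgue ((\<lambda>x. 1 *\<^sub>R x + v j) ` V) = emeasure lebesgue V"
      by (subst emeasure_lebesgue_affine) simp
    then show ?thesis
      using V open_V[of j] by (simp add: add.commute emeasure_completion borel_open cong: image_cong)
  qed
  moreover have "(\<Sum>j<k. emeasure lborel ((+) (v j) ` V)) =
      emeasure lborel (\<Union>j<k. (+) (v j) ` V)"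
  proof (rule sum_emeasure)
    show "(\<lambda>j. (+) (v j) ` V) ` {..<k} \<subseteq> sets lborel"
      using open_V by (auto intro: borel_open)
    show "disjoint_family_on (\<lambda>j. (+) (v j) ` V) {..<k}"
      unfolding disjoint_family_on_def
    proof (intro ballI impI)
      fix i j assume "i \<in> {..<k}" "j \<in> {..<k}" "i \<noteq> j"
      then show "(+) (v i) ` V \<inter> (+) (v j) ` V = {}" using disj[of i j] by fastforce
    qed
  qed simp
  ultimately show ?thesis
    by (simp add: ennreal_of_nat_eq_real_of_nat ennreal_mult \<open>0 \<le> c\<close>)
qed

text \<open>The frontier of a convex set is negligible, so passing to the interior keeps the
  volume.\<close>

lemma emeasure_scaled_interior:
  fixes K :: "'a::euclidean_space set"
  assumes K: "symmetric_convex_body K" and r: "r > 0"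
  shows "emeasure lborel ((*\<^sub>R) r ` interior K) = ennreal (r ^ DIM('a) * measure lebesgue K)"
proof -
  have K': "compact K" "convex K" using K by (auto simp: symmetric_convex_body_def)
  have "open ((*\<^sub>R) r ` interior K)" using r by (simp add: open_scaling)
  then have "emeasure lborel ((*\<^sub>R) r ` interior K) = emeasure lebesgue ((*\<^sub>R) r ` interior K)"
    by (simp add: borel_open)
  also have "\<dots> = ennreal (r ^ DIM('a)) * emeasure lebesgue (interior K)"
    using emeasure_lebesgue_affine[of r 0 "interior K"] r by simp
  also have "emeasure lebesgue (interior K) = ennreal (measure lebesgue (interior K))"
    using K' bounded_interior compact_imp_bounded
    by (intro emeasure_eq_measure2 lmeasurable_open) auto
  also have "measure lebesgue (interior K) = measure lebesgue K"
    using K' by (intro measure_interior compact_imp_bounded negligible_convex_frontier)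
  finally show ?thesis
    using r by (simp add: ennreal_mult)
qed

text \<open>The translates of \<open>(\<alpha>/2) int K\<close> along the segment from \<open>0\<close> to a shortest vector \<open>x\<close> outside the
  sublattices, spaced by \<open>\<alpha>\<close>, pack modulo \<open>M\<close>: a point of \<open>M\<close> violating this would shorten the
  coset \<open>x + M\<close>.\<close>
lemma segment_packing:
  fixes K L M U :: "'a::euclidean_space set"
  assumes K: "symmetric_convex_body K" "interior K \<noteq> {}"
    and L: "euclidean_lattice L" and M: "euclidean_lattice M" "\<not> M \<subseteq> {0}"
    and U: "0 \<in> U" "\<not> L \<subseteq> U" "\<And>y. y \<in> U \<Longrightarrow> - y \<in> U" and shift: "\<And>y m. y \<in> L - U \<Longrightarrow> m \<in> M \<Longrightarrow> y - m \<in> L - U"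
    and k: "real k * successive_min 1 K M \<le> successive_min 1 K (L - U)"
  defines "r \<equiv> successive_min 1 K M / 2"
  shows "\<exists>v :: nat \<Rightarrow> 'a.
    (\<forall>i<k. \<forall>j<k. \<forall>a\<in>(*\<^sub>R) r ` interior K. \<forall>b\<in>(*\<^sub>R) r ` interior K.
      ((v i + a) - (v j + b) \<in> M \<longrightarrow> i = j \<and> a = b) \<and>
      ((v i + a) - (v j + b) \<in> L \<longrightarrow> (v i + a) - (v j + b) \<in> U))"
proof -
  define \<alpha> where "\<alpha> = successive_min 1 K M"
  define \<beta> where "\<beta> = successive_min 1 K (L - U)"
  have ud: "uniform_discrete M" "uniform_discrete (L - U)"
    using lattice_uniform_discrete[OF M(1)] uniform_discrete_subset[OF lattice_uniform_discrete[OF L]]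
    by auto
  have LU: "\<not> L - U \<subseteq> {0}" using U by blast
  have pos: "0 < \<alpha>" "0 < \<beta>"
    unfolding \<alpha>_def \<beta>_def using successive_min_one(1)[OF K] ud M(2) LU by auto
  have M_min: "\<alpha> \<le> l" if "x \<in> M" "x \<noteq> 0" "0 \<le> l" "x \<in> (*\<^sub>R) l ` K" for l x
    unfolding \<alpha>_def using successive_min_one(3)[OF K ud(1) M(2)] that by blast
  \<comment> \<open>Points outside \<open>U\<close> are nonzero because \<open>0\<close> lies in
    \<open>U\<close>.\<close>
  have U_min: "\<beta> \<le> l" if "x \<in> L - U" "0 \<le> l" "x \<in> (*\<^sub>R) l ` K" for l x
    unfolding \<beta>_def using successive_min_one(3)[OF K ud(2) LU that(1) _ that(2,3)] that(1) U(1) by blast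
  obtain x where x: "x \<in> L - U" "x \<in> (*\<^sub>R) \<beta> ` K"
    unfolding \<beta>_def using successive_min_one(2)[OF K ud(2) LU] by blast
  have scaleK: "t *\<^sub>R x \<in> (*\<^sub>R) (t * \<beta>) ` K" for t
    using x(2) by force
  \<comment> \<open>Since \<open>x\<close> lies in the dilate by \<beta>, one step of
    \<alpha>/\<beta> times \<open>x\<close> lies in the dilate by \<alpha>.\<close>
  define v where "v i = (real i * \<alpha> / \<beta>) *\<^sub>R x" for i
  have diff: "\<exists>l. 0 \<le> l \<and> l < \<alpha> \<and> a - b \<in> (*\<^sub>R) l ` K"
    if a: "a \<in> (*\<^sub>R) r ` interior K" and b: "b \<in> (*\<^sub>R) r ` interior K" for a b
  proof -
    have r: "r > 0" using pos by (simp add: r_def \<alpha>_def)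
    obtain l where l: "0 \<le> l" "l < r" "a \<in> (*\<^sub>R) l ` K"
      using body_scale_interior[OF K a r] by blast
    obtain m where m: "0 \<le> m" "m < r" "b \<in> (*\<^sub>R) m ` K"
      using body_scale_interior[OF K b r] by blast
    have "a + - b \<in> (*\<^sub>R) (l + m) ` K"
      using body_scale_add[OF K l(3) body_scale_minus[OF K m(3)] l(1) m(1)] .
    then show ?thesis using l m by (intro exI[of _ "l + m"]) (auto simp: r_def \<alpha>_def)
  qed
  have vdiff: "v i - v j = ((real i - real j) * \<alpha> / \<beta>) *\<^sub>R x" for i j
    by (simp add: v_def algebra_simps diff_divide_distrib)
  \<comment> \<open>The largest index is \<open>k - 1\<close>, which leaves room for one more
    \<alpha>; the strict bound \<open>l < \<alpha>\<close> on differences within the body uses it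
    up.\<close>
  have le: "(i - j) * \<alpha> + \<alpha> \<le> \<beta>" if "i < k" for i j :: nat
  proof -
    have "real (i - j) + 1 \<le> real k" using that by linarith
    then have "(real (i - j) + 1) * \<alpha> \<le> real k * \<alpha>" using pos by (intro mult_right_mono) auto
    then show ?thesis using k by (simp add: \<alpha>_def \<beta>_def algebra_simps)
  qed
  have noM: "(v i + a) - (v j + b) \<notin> M"
    if ij: "j < i" "i < k" and a: "a \<in> (*\<^sub>R) r ` interior K" and b: "b \<in> (*\<^sub>R) r ` interior K" for i j a b
  proof
    assume z: "(v i + a) - (v j + b) \<in> M"
    obtain l where l: "0 \<le> l" "l < \<alpha>" "b - a \<in> (*\<^sub>R) l ` K"
      using diff[OF b a] by blast
    \<comment> \<open>Subtracting the supposed point of \<open>M\<close> from \<open>x\<close>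
      leaves the fraction \<open>t\<close> of \<open>x\<close> plus \<open>b - a\<close>. By
      \<open>shift\<close> this is again in \<open>L - U\<close>, yet its factor \<beta> - (i - j)
      \<alpha> + l is below \<beta>.\<close>
    define t where "t = 1 - (real i - real j) * \<alpha> / \<beta>"
    have "real (i - j) * \<alpha> \<le> \<beta>" using le[OF ij(2), of j] pos by linarith
    then have t: "0 \<le> t" using pos ij by (simp add: t_def field_simps of_nat_diff)
    have "t *\<^sub>R x + (b - a) \<in> (*\<^sub>R) (t * \<beta> + l) ` K"
      using body_scale_add[OF K scaleK l(3) _ l(1)] t pos by simp
    moreover have "x - ((v i + a) - (v j + b)) = t *\<^sub>R x + (b - a)"
      using vdiff[of i j] by (simp add: t_def algebra_simps)
    ultimately have "x - ((v i + a) - (v j + b)) \<in> (*\<^sub>R) (t * \<beta> + l) ` K"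
      by (simp only:)
    then have "\<beta> \<le> t * \<beta> + l"
      using U_min[OF shift[OF x(1) z]] t pos l by simp
    moreover have "t * \<beta> = \<beta> - (real i - real j) * \<alpha>"
      using pos by (simp add: t_def field_simps)
    moreover have "1 * \<alpha> \<le> (real i - real j) * \<alpha>"
      using ij pos by (intro mult_right_mono) auto
    ultimately show False using l by linarith
  qed
  have U_mem: "(v i + a) - (v j + b) \<in> U"
    if ij: "j \<le> i" "i < k" and a: "a \<in> (*\<^sub>R) r ` interior K" and b: "b \<in> (*\<^sub>R) r ` interior K"
      and z: "(v i + a) - (v j + b) \<in> L" for i j a b
  proof (rule ccontr)
    assume nz: "(v i + a) - (v j + b) \<notin> U"
    obtain l where l: "0 \<le> l" "l < \<alpha>" "a - b \<in> (*\<^sub>R) l ` K"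
      using diff[OF a b] by blast
    \<comment> \<open>The factor of the difference is at most (i - j) \<alpha> + l, which
      \<open>le\<close> puts below \<beta>; so the difference cannot be a point of
      \<open>L - U\<close>.\<close>
    define t where "t = (real i - real j) * \<alpha> / \<beta>"
    have t: "0 \<le> t" using pos ij by (simp add: t_def)
    have tm: "t * \<beta> = (real i - real j) * \<alpha>" using pos by (simp add: t_def)
    have "t *\<^sub>R x + (a - b) \<in> (*\<^sub>R) (t * \<beta> + l) ` K"
      using body_scale_add[OF K scaleK l(3) _ l(1)] t pos by simp
    moreover have "(v i + a) - (v j + b) = t *\<^sub>R x + (a - b)"
      using vdiff[of i j] by (simp add: t_def algebra_simps)
    ultimately have "(v i + a) - (v j + b) \<in> (*\<^sub>R) (t * \<beta> + l) ` K"
      by (simp only:)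
    then have "\<beta> \<le> t * \<beta> + l"
      using U_min[of "(v i + a) - (v j + b)" "t * \<beta> + l"] z nz t pos l by simp
    then show False using le[OF ij(2), of j] l ij tm by (simp add: of_nat_diff)
  qed
  have minus: "(v i + a) - (v j + b) = - ((v j + b) - (v i + a))" for i j a b
    by simp
  show ?thesis
  proof (intro exI[of _ v] allI impI ballI conjI)
    fix i j a b
    assume ij: "i < k" "j < k"
      and ab: "a \<in> (*\<^sub>R) r ` interior K" "b \<in> (*\<^sub>R) r ` interior K"
    show "(v i + a) - (v j + b) \<in> U" if z: "(v i + a) - (v j + b) \<in> L"
    proof (cases "j \<le> i")
      case True
      then show ?thesis using U_mem ij ab z by blast
    next
      case False
      have "(v j + b) - (v i + a) \<in> L" using lattice_minus[OF L z] by simp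
      then have "(v j + b) - (v i + a) \<in> U" using False U_mem ij ab by simp
      then show ?thesis using U(3) minus by metis
    qed
    assume z: "(v i + a) - (v j + b) \<in> M"
    have z': "(v j + b) - (v i + a) \<in> M" using lattice_minus[OF M(1) z] by simp
    show "i = j" using noM[of j i a b] noM[of i j b a] z z' ij ab by (metis linorder_neqE_nat)
    then have "a - b \<in> M" using z by simp
    moreover obtain l where "0 \<le> l" "l < \<alpha>" "a - b \<in> (*\<^sub>R) l ` K"
      using diff[OF ab] by blast
    \<comment> \<open>A nonzero point of \<open>M\<close> would need a factor of at least
      \<alpha>.\<close>
    ultimately show "a = b" using M_min[of "a - b" l] by force
  qed
qed

section \<open>The final estimate\<close>

lemma card_cosets_pos:
  assumes "0 \<in> X" "finite (cosets M X)"
  shows "1 \<le> card (cosets M X)"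
  using assms by (auto simp: cosets_def Suc_le_eq card_gt_0_iff)

theorem theorem1p2:
  fixes K \<Lambda> \<Lambda>bar :: "(real ^ 'n) set"
    and \<Lambda>s :: "nat \<Rightarrow> (real ^ 'n) set"
    and s :: nat
  assumes n: "CARD('n) \<ge> 2"
    and K: "symmetric_convex_body K" "interior K \<noteq> {}"
    and \<Lambda>: "euclidean_lattice \<Lambda>" "dim \<Lambda> = CARD('n)"
    and s: "s \<ge> 1"
    and \<Lambda>s: "\<And>i. i \<in> {1..s} \<Longrightarrow> euclidean_lattice (\<Lambda>s i) \<and> dim (\<Lambda>s i) = CARD('n) \<and> \<Lambda>s i \<subseteq> \<Lambda>"
    and proper: "(\<Union>i\<in>{1..s}. \<Lambda>s i) \<noteq> \<Lambda>"
    and \<Lambda>bar: "\<Lambda>bar = (\<Inter>i\<in>{1..s}. \<Lambda>s i)"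
  shows "euclidean_lattice \<Lambda>bar \<and> dim \<Lambda>bar = CARD('n) \<and>
    successive_min 1 K (\<Lambda> - (\<Union>i\<in>{1..s}. \<Lambda>s i))
      < 2 ^ CARD('n) * lattice_det \<Lambda>
          / (successive_min 1 K \<Lambda>bar ^ (CARD('n) - 1) * measure lebesgue K)
          * ((\<Sum>i=1..s. lattice_det \<Lambda>bar / lattice_det (\<Lambda>s i)) - real s + 1)
        + successive_min 1 K \<Lambda>bar"
proof -
  let ?n = "CARD('n)"
  define U where "U = (\<Union>i\<in>{1..s}. \<Lambda>s i)"
  have lat: "euclidean_lattice (\<Lambda>s i)" "dim (\<Lambda>s i) = DIM(real ^ 'n)" "\<Lambda>s i \<subseteq> \<Lambda>"
    if "i \<in> {1..s}" for i
    using \<Lambda>s[OF that] by simp_all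
  have dim\<Lambda>: "dim \<Lambda> = DIM(real ^ 'n)" using \<Lambda>(2) by simp
  have bar: "euclidean_lattice \<Lambda>bar"
    unfolding \<Lambda>bar using s lat by (intro lattice_INT) auto
  have dimbar: "dim \<Lambda>bar = DIM(real ^ 'n)"
    unfolding \<Lambda>bar using lat by (intro dim_INT_full[OF \<Lambda>(1) dim\<Lambda>]) auto
  have bar_sub: "\<Lambda>bar \<subseteq> \<Lambda>s i" if "i \<in> {1..s}" for i using that by (auto simp: \<Lambda>bar)
  have one: "1 \<in> {1..s}" using s by simp
  define \<alpha> where "\<alpha> = successive_min 1 K \<Lambda>bar"
  define \<beta> where "\<beta> = successive_min 1 K (\<Lambda> - U)"
  define N where "N = card (cosets \<Lambda>bar U)"
  define R where "R = (\<Sum>i=1..s. lattice_det \<Lambda>bar / lattice_det (\<Lambda>s i)) - real s + 1"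
  have nz: "\<not> \<Lambda>bar \<subseteq> {0}"
    using dimbar dim_eq_0[of \<Lambda>bar] by (metis DIM_positive less_irrefl)
  have lam: "0 < \<alpha>"
    unfolding \<alpha>_def by (rule successive_min_one(1)[OF K lattice_uniform_discrete[OF bar] nz])
  have fin: "0 \<in> \<Lambda>s i \<and> finite (cosets \<Lambda>bar (\<Lambda>s i))" if "i \<in> {1..s}" for i
    using lattice_zero[OF lat(1)[OF that]] finite_cosets[OF lat(1)[OF that] bar bar_sub[OF that] dimbar]
    by simp
  have finU: "finite (cosets \<Lambda>bar U)"
    and N_le: "N \<le> 1 + (\<Sum>i\<in>{1..s}. card (cosets \<Lambda>bar (\<Lambda>s i)) - 1)"
    using card_cosets_UN_le[of "{1..s}" \<Lambda>s \<Lambda>bar] fin by (auto simp: U_def N_def)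
  have "real N \<le> 1 + (\<Sum>i\<in>{1..s}. real (card (cosets \<Lambda>bar (\<Lambda>s i)) - 1))"
    using N_le by (metis of_nat_1 of_nat_add of_nat_le_iff of_nat_sum)
  also have "\<dots> \<le> 1 + (\<Sum>i\<in>{1..s}. lattice_det \<Lambda>bar / lattice_det (\<Lambda>s i) - 1)"
  proof (intro add_left_mono sum_mono)
    fix i assume i: "i \<in> {1..s}"
    \<comment> \<open>Every sublattice contains \<open>0\<close>, so the coset count is at least 1
      and the truncated subtraction is an honest one.\<close>
    show "real (card (cosets \<Lambda>bar (\<Lambda>s i)) - 1) \<le> lattice_det \<Lambda>bar / lattice_det (\<Lambda>s i) - 1"
      using card_cosets_le_det_ratio[OF lat(1,2)[OF i] bar bar_sub[OF i] dimbar]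
        card_cosets_pos[of "\<Lambda>s i" \<Lambda>bar] fin[OF i] by (simp add: of_nat_diff)
  qed
  also have "\<dots> = R" by (simp add: R_def sum_subtractf)
  finally have NR: "real N \<le> R" .
  \<comment> \<open>If \<beta> < \<alpha> then \<open>k = 0\<close>, the packing is empty and the
    argument still runs. The strict bound \<beta>/\<alpha> < k + 1 is the source of the strict
    inequality in the conclusion.\<close>
  define k where "k = nat \<lfloor>\<beta> / \<alpha>\<rfloor>"
  have U0: "0 \<in> U" using fin[OF one] one by (auto simp: U_def)
  have LU: "\<not> \<Lambda> \<subseteq> U" using proper lat(3) unfolding U_def by blast
  have Uminus: "- y \<in> U" if "y \<in> U" for y
    using that lattice_minus lat(1) unfolding U_def by blast
  \<comment> \<open>The complement of the union is invariant under \<open>\<Lambda>bar\<close>, as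
    \<open>\<Lambda>bar\<close> lies in each sublattice: if \<open>y - m\<close> were in one of
    them, so would be \<open>y\<close>.\<close>
  have shift: "y - m \<in> \<Lambda> - U" if y: "y \<in> \<Lambda> - U" and m: "m \<in> \<Lambda>bar" for y m
  proof -
    have "y - m \<in> \<Lambda>" using lattice_diff[OF \<Lambda>(1)] y m bar_sub[OF one] lat(3)[OF one] by blast
    moreover have "y - m \<notin> \<Lambda>s i" if "i \<in> {1..s}" for i
      using lattice_add[OF lat(1)[OF that], of "y - m" m] y m bar_sub[OF that] that
      by (auto simp: U_def)
    ultimately show ?thesis by (auto simp: U_def)
  qed
  have "0 < \<beta>"
    unfolding \<beta>_def
    using LU U0 uniform_discrete_subset[OF lattice_uniform_discrete[OF \<Lambda>(1)]]
    by (intro successive_min_one(1)[OF K]) auto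
  then have k: "real k \<le> \<beta> / \<alpha>" "\<beta> / \<alpha> < real k + 1"
    using lam by (auto simp: k_def)
  then have k': "real k * successive_min 1 K \<Lambda>bar \<le> successive_min 1 K (\<Lambda> - U)"
    using lam by (simp add: pos_le_divide_eq \<alpha>_def \<beta>_def)
  define V where "V = (*\<^sub>R) (\<alpha> / 2) ` interior K"
  obtain v :: "nat \<Rightarrow> real ^ 'n" where v: "\<forall>i<k. \<forall>j<k. \<forall>a\<in>V. \<forall>b\<in>V.
      ((v i + a) - (v j + b) \<in> \<Lambda>bar \<longrightarrow> i = j \<and> a = b) \<and>
      ((v i + a) - (v j + b) \<in> \<Lambda> \<longrightarrow> (v i + a) - (v j + b) \<in> U)"
    using segment_packing[OF K \<Lambda>(1) bar nz U0 LU Uminus shift k', folded \<alpha>_def, folded V_def] ..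
  define S where "S = (\<Union>j<k. (+) (v j) ` V)"
  define c where "c = (\<alpha> / 2) ^ ?n * measure lebesgue K"
  have "open V" using lam unfolding V_def by (intro open_scaling) auto
  have emV: "emeasure lborel V = ennreal c"
    using emeasure_scaled_interior[OF K(1), of "\<alpha> / 2"] lam by (simp add: V_def c_def)
  have "open S" using \<open>open V\<close> unfolding S_def by (intro open_UN ballI open_translation)
  have emS: "emeasure lborel S = ennreal (real k * c)"
    unfolding S_def
  proof (rule emeasure_disjoint_translates[OF \<open>open V\<close> emV])
    show "0 \<le> c" using lam by (simp add: c_def)
    \<comment> \<open>Equal points differ by \<open>0\<close>, an element of
      \<open>\<Lambda>bar\<close>, so packing modulo \<open>\<Lambda>bar\<close> includes ordinary
      disjointness.\<close>
    show "i = j" if "i < k" "j < k" "x \<in> V" "y \<in> V" "v i + x = v j + y" for i j x y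
      using v that lattice_zero[OF bar] by (metis diff_self)
  qed
  obtain D where D: "fundamental_domain \<Lambda> D" "lattice_det \<Lambda> = measure lborel D"
    using lattice_det_fundamental_domain[OF \<Lambda>(1) dim\<Lambda>] by blast
  have "emeasure lborel S \<le> of_nat N * emeasure lborel D"
  proof (rule emeasure_le_lattice_count[OF countable_lattice[OF \<Lambda>(1)] D(1)])
    show "S \<in> sets borel" using \<open>open S\<close> by (rule borel_open)
    show "finite {z\<in>\<Lambda>. x + z \<in> S} \<and> card {z\<in>\<Lambda>. x + z \<in> S} \<le> N" for x
      unfolding N_def
    proof (rule card_translate_le_cosets[OF bar finU _ _ \<Lambda>(1)])
      show "a = b" if "a \<in> S" "b \<in> S" "a - b \<in> \<Lambda>bar" for a b
        using that v unfolding S_def by fast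
      show "a - b \<in> U" if "a \<in> S" "b \<in> S" "a - b \<in> \<Lambda>" for a b
        using that v unfolding S_def by fast
    qed
  qed
  also have "emeasure lborel D = ennreal (lattice_det \<Lambda>)"
    using emeasure_fundamental_domain_finite[OF D(1)] D(2)
    by (simp add: emeasure_eq_ennreal_measure)
  finally have "ennreal (real k * c) \<le> ennreal (real N * lattice_det \<Lambda>)"
    using lattice_det_pos[OF \<Lambda>(1) dim\<Lambda>]
    by (simp add: emS ennreal_mult ennreal_of_nat_eq_real_of_nat)
  then have "real k * c \<le> real N * lattice_det \<Lambda>"
    using lattice_det_pos[OF \<Lambda>(1) dim\<Lambda>] by (subst (asm) ennreal_le_iff) auto
  also have "\<dots> \<le> R * lattice_det \<Lambda>"
    using NR lattice_det_pos[OF \<Lambda>(1) dim\<Lambda>] by (intro mult_right_mono) auto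
  finally have main: "real k * c \<le> R * lattice_det \<Lambda>" .
  have K': "compact K" "convex K" using K(1) by (auto simp: symmetric_convex_body_def)
  have volK: "0 < measure lebesgue K"
    using negligible_convex_interior[OF K'(2)] K(2)
      negligible_iff_measure0[OF lmeasurable_compact[OF K'(1)]]
    by (metis measure_nonneg less_le)
  \<comment> \<open>Splitting off one factor \<alpha> from the volume \<open>c\<close> turns
    \<open>main\<close> into a bound on \<open>k\<close> times \<alpha>, which is within \<alpha> of
    \<beta>.\<close>
  have "\<alpha> ^ ?n = \<alpha> * \<alpha> ^ (?n - 1)"
    by (metis One_nat_def Suc_pred power_Suc zero_less_card_finite)
  then have c: "c = \<alpha> * (\<alpha> ^ (?n - 1) * measure lebesgue K) / 2 ^ ?n"
    by (simp add: c_def power_divide)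
  have "\<beta> < real k * \<alpha> + \<alpha>"
    using k(2) lam by (simp add: pos_divide_less_eq algebra_simps)
  moreover have "real k * \<alpha> \<le> 2 ^ ?n * lattice_det \<Lambda> / (\<alpha> ^ (?n - 1) * measure lebesgue K) * R"
    using main lam volK by (simp add: c field_simps)
  ultimately have "\<beta> < 2 ^ ?n * lattice_det \<Lambda> / (\<alpha> ^ (?n - 1) * measure lebesgue K) * R + \<alpha>"
    by linarith
  then show ?thesis
    using bar dimbar by (simp add: \<beta>_def \<alpha>_def R_def U_def)
qed

end
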